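(* Let $n\geqslant 1$, $d\geqslant 1$, let $\tilde c_1,\dots,\tilde c_n\in\mathbb{R}^d$, and let $A_1,\dots,A_n\in S_{++}^d$. Let $\lambda^*$ be a minimizer of $F$ over $\Delta^n$, and set $$\alpha=\max_{1\leqslant i\leqslant n}\|\tilde c_i-m(\lambda^* )\|_{A_i}^2 .$$ Then the smallest radius $r^*\geqslant 0$ that yields a non-empty intersection $\bigcap_{i=1}^n E_{r}(\tilde c_i,A_i)$ is $$r^*=\sqrt{\alpha}=\sqrt{h(\lambda^* )}=\sqrt{\sum_{i=1}^n\lambda_i^*\,\tilde c_i^\top A_i\tilde c_i-b(\lambda^* )^\top A(\lambda^* )^{-1}b(\lambda^* )}\,,$$ hence $g(\lambda^*;r^* )=0$, and so $E_{\lambda^*,r^*}=\{m(\lambda^* )\}$.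
   Context: $S_{++}^d$ is the set of real symmetric positive definite $d\times d$ matrices. For $A\in S_{++}^d$, $\|z\|_A=\sqrt{z^\top A z}$. For $r\geqslant 0$, $E_r(\tilde c,A)=\{x\in\mathbb{R}^d : (x-\tilde c)^\top A(x-\tilde c)\leqslant r^2\}$. The probability simplex is $\Delta^n=\{\lambda\in\mathbb{R}^n:\lambda_i\geqslant 0 \text{ for all } i,\ \sum_{i=1}^n\lambda_i=1\}$. Given $\tilde c_1,\dots,\tilde c_n$ and $A_1,\dots,A_n$, put $b_i=-A_i\tilde c_i$, $\gamma_i(r)=\tilde c_i^\top A_i\tilde c_i-r^2$, and $f_i(x;r)=x^\top A_ix+2b_i^\top x+\gamma_i(r)$ (so that $E_r(\tilde c_i,A_i)=\{x:f_i(x;r)\leqslant 0\}$). For $\lambda\in\mathbb{R}^n$ with all $\lambda_i\geqslant 0$ and $\lambda\neq 0$, put $A(\lambda)=\sum_i\lambda_iA_i$ (which is positive definite), $b(\lambda)=\sum_i\lambda_ib_i$, $\gamma(\lambda;r)=\sum_i\lambda_i\gamma_i(r)$, $m(\lambda)=-A(\lambda)^{-1}b(\lambda)$, $$g(\lambda;r)=\gamma(\lambda;r)-b(\lambda)^\top A(\lambda)^{-1}b(\lambda),$$ $$h(\lambda)=\sum_{i=1}^n\lambda_i\tilde c_i^\top A_i\tilde c_i-b(\lambda)^\top A(\lambda)^{-1}b(\lambda),\qquad F(\lambda)=-h(\lambda),$$ and $E_{\lambda,r}=\{x\in\mathbb{R}^d:\sum_{i=1}^n\lambda_if_i(x;r)\leqslant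 0\}$. *)

theory Defs
  imports "HOL-Analysis.Analysis"
begin

text \<open>
  The ambient space is \<open>real ^ 'd\<close> and the ellipsoids are indexed by a finite type \<open>'n\<close>, so that
  \<open>d = CARD('d) \<ge> 1\<close> and \<open>n = CARD('n) \<ge> 1\<close>. The ellipsoids have centres \<open>c i\<close> and
  shape matrices \<open>A i\<close>; weights are vectors \<open>l :: real ^ 'n\<close>.
\<close>

definition spd :: "real ^ 'd ^ 'd \<Rightarrow> bool" where
  "spd A \<longleftrightarrow> transpose A = A \<and> (\<forall>z. z \<noteq> 0 \<longrightarrow> z \<bullet> (A *v z) > 0)"

definition mat_norm :: "real ^ 'd ^ 'd \<Rightarrow> real ^ 'd \<Rightarrow> real" where
  "mat_norm A z = sqrt (z \<bullet> (A *v z))"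

definition ellipsoid :: "real \<Rightarrow> real ^ 'd \<Rightarrow> real ^ 'd ^ 'd \<Rightarrow> (real ^ 'd) set" where
  "ellipsoid r c A = {x. (x - c) \<bullet> (A *v (x - c)) \<le> r\<^sup>2}"

definition prob_simplex :: "(real ^ 'n) set" where
  "prob_simplex = {l. (\<forall>i. l $ i \<ge> 0) \<and> (\<Sum>i\<in>UNIV. l $ i) = 1}"

definition b_vec :: "('n \<Rightarrow> real ^ 'd) \<Rightarrow> ('n \<Rightarrow> real ^ 'd ^ 'd) \<Rightarrow> 'n \<Rightarrow> real ^ 'd" where
  "b_vec c A i = - (A i *v c i)"

definition gamma_const ::
  "('n \<Rightarrow> real ^ 'd) \<Rightarrow> ('n \<Rightarrow> real ^ 'd ^ 'd) \<Rightarrow> 'n \<Rightarrow> real \<Rightarrow> real" where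
  "gamma_const c A i r = c i \<bullet> (A i *v c i) - r\<^sup>2"

definition quad_fun ::
  "('n \<Rightarrow> real ^ 'd) \<Rightarrow> ('n \<Rightarrow> real ^ 'd ^ 'd) \<Rightarrow> 'n \<Rightarrow> real ^ 'd \<Rightarrow> real \<Rightarrow> real" where
  "quad_fun c A i x r = x \<bullet> (A i *v x) + 2 * (b_vec c A i \<bullet> x) + gamma_const c A i r"

text \<open>
  The definitions below are meant for weights \<open>l \<noteq> 0\<close> with nonnegative entries and for
  positive definite \<open>A i\<close>; then \<open>A_comb A l\<close> is positive definite and \<open>matrix_inv\<close> is its
  genuine inverse.
\<close>

definition A_comb :: "('n::finite \<Rightarrow> real ^ 'd ^ 'd) \<Rightarrow> real ^ 'n \<Rightarrow> real ^ 'd ^ 'd" where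
  "A_comb A l = (\<Sum>i\<in>UNIV. l $ i *\<^sub>R A i)"

definition b_comb ::
  "('n::finite \<Rightarrow> real ^ 'd) \<Rightarrow> ('n \<Rightarrow> real ^ 'd ^ 'd) \<Rightarrow> real ^ 'n \<Rightarrow> real ^ 'd" where
  "b_comb c A l = (\<Sum>i\<in>UNIV. l $ i *\<^sub>R b_vec c A i)"

definition gamma_comb ::
  "('n::finite \<Rightarrow> real ^ 'd) \<Rightarrow> ('n \<Rightarrow> real ^ 'd ^ 'd) \<Rightarrow> real ^ 'n \<Rightarrow> real \<Rightarrow> real" where
  "gamma_comb c A l r = (\<Sum>i\<in>UNIV. l $ i * gamma_const c A i r)"

definition m_comb ::
  "('n::finite \<Rightarrow> real ^ 'd) \<Rightarrow> ('n \<Rightarrow> real ^ 'd ^ 'd) \<Rightarrow> real ^ 'n \<Rightarrow> real ^ 'd" where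
  "m_comb c A l = - (matrix_inv (A_comb A l) *v b_comb c A l)"

definition g_fun ::
  "('n::finite \<Rightarrow> real ^ 'd) \<Rightarrow> ('n \<Rightarrow> real ^ 'd ^ 'd) \<Rightarrow> real ^ 'n \<Rightarrow> real \<Rightarrow> real" where
  "g_fun c A l r =
     gamma_comb c A l r - b_comb c A l \<bullet> (matrix_inv (A_comb A l) *v b_comb c A l)"

definition h_fun ::
  "('n::finite \<Rightarrow> real ^ 'd) \<Rightarrow> ('n \<Rightarrow> real ^ 'd ^ 'd) \<Rightarrow> real ^ 'n \<Rightarrow> real" where
  "h_fun c A l =
     (\<Sum>i\<in>UNIV. l $ i * (c i \<bullet> (A i *v c i)))
       - b_comb c A l \<bullet> (matrix_inv (A_comb A l) *v b_comb c A l)"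

definition F_fun ::
  "('n::finite \<Rightarrow> real ^ 'd) \<Rightarrow> ('n \<Rightarrow> real ^ 'd ^ 'd) \<Rightarrow> real ^ 'n \<Rightarrow> real" where
  "F_fun c A l = - h_fun c A l"

definition E_comb ::
  "('n::finite \<Rightarrow> real ^ 'd) \<Rightarrow> ('n \<Rightarrow> real ^ 'd ^ 'd) \<Rightarrow> real ^ 'n \<Rightarrow> real \<Rightarrow> (real ^ 'd) set" where
  "E_comb c A l r = {x. (\<Sum>i\<in>UNIV. l $ i * quad_fun c A i x r) \<le> 0}"

definition smallest_radius ::
  "('n \<Rightarrow> real ^ 'd) \<Rightarrow> ('n \<Rightarrow> real ^ 'd ^ 'd) \<Rightarrow> real \<Rightarrow> bool" where
  "smallest_radius c A r \<longleftrightarrow>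
     r \<ge> 0 \<and> (\<Inter>i. ellipsoid r (c i) (A i)) \<noteq> {} \<and>
     (\<forall>s\<ge>0. (\<Inter>i. ellipsoid s (c i) (A i)) \<noteq> {} \<longrightarrow> r \<le> s)"

end

theory Submission
  imports Defs
begin

text \<open>
  Let \<open>q i x\<close> be the squared \<open>A i\<close>-distance from \<open>c i\<close> to \<open>x\<close>. Completing the square gives
  \<open>\<Sum>i. l i * q i x = h l + (x - m l) \<bullet> A(l) (x - m l)\<close>, so \<open>h l\<close> is the minimum over \<open>x\<close> of the
  weighted sum, attained only at \<open>m l\<close>. If \<open>lstar\<close> maximises \<open>h\<close>, moving the weight slightly towards
  a vertex \<open>j\<close> of the simplex gives \<open>q j (m lstar) \<le> h lstar\<close>. The average of the
  \<open>q i (m lstar)\<close> with weights \<open>lstar\<close> is \<open>h lstar\<close>, hence so is their maximum; conversely any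
  point of the intersection for radius \<open>s\<close> has weighted sum at most \<open>s\<^sup>2\<close>, so \<open>h lstar \<le> s\<^sup>2\<close>.
\<close>

section \<open>Positive definite matrices\<close>

lemma spd_sym:
  assumes "spd A"
  shows "x \<bullet> (A *v y) = y \<bullet> (A *v x)"
  using assms by (metis spd_def dot_lmul_matrix inner_commute transpose_matrix_vector)

lemma spd_pos: "spd A \<Longrightarrow> z \<noteq> 0 \<Longrightarrow> z \<bullet> (A *v z) > 0"
  by (simp add: spd_def)

lemma spd_nonneg: "spd A \<Longrightarrow> z \<bullet> (A *v z) \<ge> 0"
  by (cases "z = 0") (auto simp: spd_def less_imp_le)

lemma spd_nonpos_iff: "spd A \<Longrightarrow> z \<bullet> (A *v z) \<le> 0 \<longleftrightarrow> z = 0"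
  using spd_pos[of A z] by (cases "z = 0") auto

text \<open>A definite form forces a trivial kernel, so the square matrix \<open>A\<close> is
  invertible; only then does the choice behind \<open>matrix_inv\<close> yield a genuine
  inverse.\<close>

lemma spd_inverse_mult:
  fixes A :: "real ^ 'd ^ 'd"
  assumes "spd A"
  shows "A *v (matrix_inv A *v x) = x"
proof -
  have "\<forall>z. A *v z = 0 \<longrightarrow> z = 0"
    using spd_pos[OF assms] by (metis inner_zero_right less_irrefl)
  then have "invertible A"
    by (simp add: invertible_left_inverse matrix_left_invertible_ker)
  then have "A ** matrix_inv A = mat 1"
    unfolding matrix_inv_def invertible_def by (rule someI2_ex) simp
  then show ?thesis
    by (simp add: matrix_vector_mul_assoc)
qed

text \<open>The constant is the minimum of the form on the compact unit sphere, and homogeneity of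
  degree two extends the bound to all \<open>z\<close>. It will turn smallness of the form into
  smallness of the norm.\<close>

lemma spd_coercive:
  fixes A :: "real ^ 'd ^ 'd"
  assumes "spd A"
  obtains k where "k > 0" "\<And>z. k * (norm z)\<^sup>2 \<le> z \<bullet> (A *v z)"
proof -
  let ?S = "sphere (0 :: real ^ 'd) 1"
  have "continuous_on ?S (\<lambda>z. z \<bullet> (A *v z))"
    by (intro continuous_intros matrix_vector_mult_linear_continuous_on)
  moreover have "?S \<noteq> {}"
    by simp
  ultimately obtain u where u: "u \<in> ?S" "\<And>z. z \<in> ?S \<Longrightarrow> u \<bullet> (A *v u) \<le> z \<bullet> (A *v z)"
    using continuous_attains_inf[OF compact_sphere, of 0 1 "\<lambda>z. z \<bullet> (A *v z)"] by blast
  show thesis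
  proof
    show "u \<bullet> (A *v u) > 0"
      using u(1) by (intro spd_pos[OF assms]) auto
    show "u \<bullet> (A *v u) * (norm z)\<^sup>2 \<le> z \<bullet> (A *v z)" for z
    proof (cases "z = 0")
      case False
      then have "u \<bullet> (A *v u) \<le> (z /\<^sub>R norm z) \<bullet> (A *v (z /\<^sub>R norm z))"
        by (intro u(2)) simp
      also have "\<dots> = (z \<bullet> (A *v z)) / (norm z)\<^sup>2"
        by (simp add: scaleR_matrix_vector_assoc[symmetric] matrix_vector_mult_scaleR
            power2_eq_square divide_inverse)
      finally show ?thesis
        using False by (simp add: field_simps)
    qed simp
  qed
qed

section \<open>Squared distances as quadratic functions\<close>

definition sq_dist :: "('n \<Rightarrow> real ^ 'd) \<Rightarrow> ('n \<Rightarrow> real ^ 'd ^ 'd) \<Rightarrow> 'n \<Rightarrow> real ^ 'd \<Rightarrow> real" where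
  "sq_dist c A i x = (x - c i) \<bullet> (A i *v (x - c i))"

lemma sq_dist_nonneg: "\<forall>i. spd (A i) \<Longrightarrow> sq_dist c A i x \<ge> 0"
  unfolding sq_dist_def by (simp add: spd_nonneg)

lemma continuous_sq_dist: "isCont (sq_dist c A i) x"
proof -
  have "continuous_on UNIV (sq_dist c A i)"
    unfolding sq_dist_def
    by (intro continuous_intros continuous_on_compose2[OF matrix_vector_mult_linear_continuous_on[of UNIV]]) auto
  then show ?thesis
    by (simp add: continuous_on_eq_continuous_at)
qed

lemma sq_dist_expand:
  assumes "\<forall>i. spd (A i)"
  shows "sq_dist c A i x = x \<bullet> (A i *v x) + 2 * (b_vec c A i \<bullet> x) + c i \<bullet> (A i *v c i)"
  using spd_sym[of "A i" x "c i"] assms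
  by (simp add: sq_dist_def b_vec_def matrix_vector_mult_diff_distrib inner_diff_left
      inner_diff_right inner_commute)

lemma quad_fun_eq_sq_dist:
  "\<forall>i. spd (A i) \<Longrightarrow> quad_fun c A i x r = sq_dist c A i x - r\<^sup>2"
  by (simp add: quad_fun_def gamma_const_def sq_dist_expand)

lemma mat_norm_eq_sq_dist:
  assumes "\<forall>i. spd (A i)"
  shows "(mat_norm (A i) (c i - x))\<^sup>2 = sq_dist c A i x"
proof -
  have "(c i - x) \<bullet> (A i *v (c i - x)) = sq_dist c A i x"
    unfolding sq_dist_def
    by (simp add: matrix_vector_mult_diff_distrib inner_diff_left inner_diff_right)
  then show ?thesis
    using sq_dist_nonneg[OF assms, of c i x] by (simp add: mat_norm_def)
qed

section \<open>Convex combinations of the quadratic functions\<close>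

lemma A_comb_mult: "A_comb A l *v x = (\<Sum>i\<in>UNIV. l $ i *\<^sub>R (A i *v x))"
proof -
  have "(\<Sum>i\<in>S. l $ i *\<^sub>R A i) *v x = (\<Sum>i\<in>S. l $ i *\<^sub>R (A i *v x))" if "finite S" for S
    using that
    by induction
      (auto simp: matrix_vector_mult_add_rdistrib scaleR_matrix_vector_assoc[symmetric])
  then show ?thesis
    by (simp add: A_comb_def)
qed

text \<open>Weights with sum 1 cannot all vanish; one positive weight makes the form strictly
  positive, since the other terms are nonnegative.\<close>

lemma spd_A_comb:
  fixes A :: "'n::finite \<Rightarrow> real ^ 'd ^ 'd"
  assumes spd: "\<forall>i. spd (A i)" and l: "l \<in> prob_simplex"
  shows "spd (A_comb A l)"
  unfolding spd_def
proof (intro conjI allI impI)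
  have "A i $ a $ b = A i $ b $ a" for i a b
    using spd arg_cong[of "transpose (A i)" "A i" "\<lambda>B. B $ a $ b"]
    unfolding spd_def by (metis transpose_def vec_lambda_beta)
  then show "transpose (A_comb A l) = A_comb A l"
    by (simp add: A_comb_def transpose_def vec_eq_iff)
next
  fix z :: "real ^ 'd"
  assume z: "z \<noteq> 0"
  obtain j where j: "l $ j \<noteq> 0"
  proof -
    have "(\<Sum>i\<in>UNIV. l $ i) \<noteq> 0"
      using l by (simp add: prob_simplex_def)
    then show thesis
      using that by (meson sum.neutral)
  qed
  have "(\<Sum>i\<in>UNIV. l $ i * (z \<bullet> (A i *v z))) > 0"
  proof (rule sum_pos2[of _ j])
    show "0 < l $ j * (z \<bullet> (A j *v z))"
      using l j z spd by (simp add: prob_simplex_def spd_pos less_le[of 0 "l $ j"])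
    show "0 \<le> l $ i * (z \<bullet> (A i *v z))" for i
      using l spd by (simp add: prob_simplex_def spd_nonneg)
  qed auto
  then show "z \<bullet> (A_comb A l *v z) > 0"
    by (simp add: A_comb_mult inner_sum_right)
qed

lemma weighted_sq_dist:
  fixes A :: "'n::finite \<Rightarrow> real ^ 'd ^ 'd"
  assumes spd: "\<forall>i. spd (A i)" and l: "l \<in> prob_simplex"
  shows "(\<Sum>i\<in>UNIV. l $ i * sq_dist c A i x) =
    h_fun c A l + (x - m_comb c A l) \<bullet> (A_comb A l *v (x - m_comb c A l))"
proof -
  let ?A = "A_comb A l" and ?b = "b_comb c A l" and ?m = "m_comb c A l"
  \<comment> \<open>The gradient of the weighted sum vanishes at \<open>?m\<close>; this identity
    produces the cross term of the completed square. Distributing over a difference from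
    \<open>0\<close> moves the minus sign out of the product.\<close>
  have Am: "?A *v ?m = - ?b"
    using spd_inverse_mult[OF spd_A_comb[OF assms], of ?b]
      matrix_vector_mult_diff_distrib[of ?A 0 "matrix_inv ?A *v ?b"]
    by (simp add: m_comb_def)
  have "(\<Sum>i\<in>UNIV. l $ i * sq_dist c A i x) =
      x \<bullet> (?A *v x) + 2 * (?b \<bullet> x) + (\<Sum>i\<in>UNIV. l $ i * (c i \<bullet> (A i *v c i)))"
    by (simp add: sq_dist_expand[OF spd] A_comb_mult b_comb_def inner_sum_left inner_sum_right
        sum.distrib sum_distrib_left algebra_simps)
  also have "\<dots> = h_fun c A l + (x - ?m) \<bullet> (?A *v (x - ?m))"
  proof -
    have "h_fun c A l = (\<Sum>i\<in>UNIV. l $ i * (c i \<bullet> (A i *v c i))) + ?b \<bullet> ?m"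
      by (simp add: h_fun_def m_comb_def)
    moreover have "(x - ?m) \<bullet> (?A *v (x - ?m)) = x \<bullet> (?A *v x) + 2 * (?b \<bullet> x) - ?b \<bullet> ?m"
      using spd_sym[OF spd_A_comb[OF assms], of ?m x]
      by (simp add: Am matrix_vector_mult_diff_distrib inner_diff_left inner_diff_right
          inner_add_right inner_commute)
    ultimately show ?thesis
      by simp
  qed
  finally show ?thesis .
qed

lemma g_fun_eq_h_fun:
  assumes "l \<in> prob_simplex"
  shows "g_fun c A l r = h_fun c A l - r\<^sup>2"
proof -
  have "(\<Sum>i\<in>UNIV. l $ i * r\<^sup>2) = r\<^sup>2"
    using assms by (simp add: prob_simplex_def sum_distrib_right[symmetric])
  then show ?thesis
    by (simp add: g_fun_def h_fun_def gamma_comb_def gamma_const_def right_diff_distrib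
        sum_subtractf)
qed

lemma weighted_quad_fun:
  fixes A :: "'n::finite \<Rightarrow> real ^ 'd ^ 'd"
  assumes spd: "\<forall>i. spd (A i)" and l: "l \<in> prob_simplex"
  shows "(\<Sum>i\<in>UNIV. l $ i * quad_fun c A i x r) =
    h_fun c A l - r\<^sup>2 + (x - m_comb c A l) \<bullet> (A_comb A l *v (x - m_comb c A l))"
proof -
  have "(\<Sum>i\<in>UNIV. l $ i * r\<^sup>2) = r\<^sup>2"
    using l by (simp add: prob_simplex_def sum_distrib_right[symmetric])
  then show ?thesis
    using weighted_sq_dist[OF assms, of c x]
    by (simp add: quad_fun_eq_sq_dist[OF spd] right_diff_distrib sum_subtractf)
qed

text \<open>First-order optimality of \<open>l\<close> in the direction of vertex \<open>j\<close>,
  obtained without differentiating \<open>h_fun\<close>. The perturbed weights give the bound only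
  at their own minimizer \<open>m' n\<close>, so convergence of \<open>m' n\<close> to
  \<open>m_comb c A l\<close> is needed as well.\<close>

lemma sq_dist_m_comb_le:
  fixes A :: "'n::finite \<Rightarrow> real ^ 'd ^ 'd"
  assumes spd: "\<forall>i. spd (A i)" and l: "l \<in> prob_simplex"
    and max: "\<And>l'. l' \<in> prob_simplex \<Longrightarrow> h_fun c A l' \<le> h_fun c A l"
  shows "sq_dist c A j (m_comb c A l) \<le> h_fun c A l"
proof -
  let ?h = "h_fun c A l" and ?m = "m_comb c A l"
  obtain k where k: "k > 0" "\<And>z. k * (norm z)\<^sup>2 \<le> z \<bullet> (A_comb A l *v z)"
    using spd_coercive[OF spd_A_comb[OF spd l]] by metis
  \<comment> \<open>The shift by 2 keeps \<open>1 - t n\<close> at least \<open>1 / 2\<close> from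
    \<open>n = 0\<close> on.\<close>
  define t :: "nat \<Rightarrow> real" where "t n = 1 / (real n + 2)" for n
  have t: "0 < t n" "t n \<le> 1 / 2" for n
    by (auto simp: t_def field_simps)
  have t0: "t \<longlonglongrightarrow> 0"
    unfolding t_def by real_asymp
  define l' where "l' n = (1 - t n) *\<^sub>R l + t n *\<^sub>R axis j 1" for n
  define m' where "m' n = m_comb c A (l' n)" for n
  have nth: "l' n $ i = (1 - t n) * l $ i + t n * (if i = j then 1 else 0)" for n i
    by (simp add: l'_def axis_def)
  have simplex: "l' n \<in> prob_simplex" for n
    using l t[of n]
    by (auto simp: prob_simplex_def nth sum.distrib sum_distrib_left[symmetric])
  \<comment> \<open>At \<open>m' n\<close> the sum with weights \<open>l' n\<close> equals
    \<open>h_fun c A (l' n)\<close>, at most \<open>?h\<close> by maximality. Splitting it by the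
    weights \<open>l\<close> and the vertex \<open>j\<close>, then completing the square for
    \<open>l\<close>, lets \<open>(1 - t n) * ?h\<close> cancel.\<close>
  have main: "(1 - t n) * ((m' n - ?m) \<bullet> (A_comb A l *v (m' n - ?m))) + t n * sq_dist c A j (m' n)
      \<le> t n * ?h" for n
  proof -
    have "(\<Sum>i\<in>UNIV. l' n $ i * sq_dist c A i (m' n)) =
        (1 - t n) * (\<Sum>i\<in>UNIV. l $ i * sq_dist c A i (m' n)) + t n * sq_dist c A j (m' n)"
    proof -
      have "l' n $ i * y = (1 - t n) * (l $ i * y) + (if i = j then t n * y else 0)" for i y
        by (simp add: nth algebra_simps)
      then show ?thesis
        by (simp add: sum.distrib sum_distrib_left)
    qed
    moreover have "(\<Sum>i\<in>UNIV. l' n $ i * sq_dist c A i (m' n)) \<le> ?h"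
      using weighted_sq_dist[OF spd simplex[of n], of c "m' n"] max[OF simplex[of n]]
      by (simp add: m'_def)
    ultimately show ?thesis
      using weighted_sq_dist[OF spd l, of c "m' n"] by (simp add: algebra_simps)
  qed
  \<comment> \<open>Drop the quadratic form from \<open>main\<close> and divide by
    \<open>t n\<close>.\<close>
  have near: "sq_dist c A j (m' n) \<le> ?h" for n
  proof -
    have "0 \<le> (1 - t n) * ((m' n - ?m) \<bullet> (A_comb A l *v (m' n - ?m)))"
      using t(2)[of n] spd_nonneg[OF spd_A_comb[OF spd l]] by simp
    then have "t n * sq_dist c A j (m' n) \<le> t n * ?h"
      using main[of n] by linarith
    then show ?thesis
      using t(1)[of n] by simp
  qed
  \<comment> \<open>Drop the other nonnegative term of \<open>main\<close> instead; coercivity then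
    bounds the squared displacement by a multiple of \<open>t n\<close>.\<close>
  have dist: "(norm (m' n - ?m))\<^sup>2 \<le> 2 * t n * ?h / k" for n
  proof -
    let ?v = "(m' n - ?m) \<bullet> (A_comb A l *v (m' n - ?m))"
    have "?v / 2 \<le> (1 - t n) * ?v"
      using mult_right_mono[of "1 / 2" "1 - t n" ?v] t(2)[of n] spd_nonneg[OF spd_A_comb[OF spd l]]
      by simp
    also have "\<dots> \<le> t n * ?h"
      using main[of n] mult_nonneg_nonneg[OF less_imp_le[OF t(1)[of n]] sq_dist_nonneg[OF spd, of c j "m' n"]]
      by linarith
    finally have "k * (norm (m' n - ?m))\<^sup>2 \<le> 2 * t n * ?h"
      using k(2)[of "m' n - ?m"] by simp
    then show ?thesis
      using k(1) by (simp add: field_simps)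
  qed
  have "(\<lambda>n. 2 * t n * ?h / k) \<longlonglongrightarrow> 2 * 0 * ?h / k"
    using k(1) by (intro tendsto_intros t0) auto
  then have bound: "(\<lambda>n. 2 * t n * ?h / k) \<longlonglongrightarrow> 0"
    by simp
  have "(\<lambda>n. (norm (m' n - ?m))\<^sup>2) \<longlonglongrightarrow> 0"
    by (rule tendsto_sandwich[OF always_eventually always_eventually tendsto_const bound])
      (simp_all only: dist zero_le_power2 simp_thms)
  then have "(\<lambda>n. sqrt ((norm (m' n - ?m))\<^sup>2)) \<longlonglongrightarrow> sqrt 0"
    by (rule tendsto_real_sqrt)
  then have "m' \<longlonglongrightarrow> ?m"
    by (simp add: tendsto_norm_zero_iff LIM_zero_iff)
  then have "(\<lambda>n. sq_dist c A j (m' n)) \<longlonglongrightarrow> sq_dist c A j ?m"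
    by (rule isCont_tendsto_compose[OF continuous_sq_dist])
  then show ?thesis
    by (rule LIMSEQ_le_const2) (use near in auto)
qed

section \<open>The smallest radius\<close>

theorem theorem2p12:
  fixes c :: "'n::finite \<Rightarrow> real ^ 'd::finite"
    and A :: "'n \<Rightarrow> real ^ 'd ^ 'd"
    and lstar :: "real ^ 'n"
    and \<alpha> :: real
  assumes "\<And>i. spd (A i)"
    and "is_arg_min (F_fun c A) (\<lambda>l. l \<in> prob_simplex) lstar"
    and "\<alpha> = Max (range (\<lambda>i. (mat_norm (A i) (c i - m_comb c A lstar))\<^sup>2))"
  shows "\<exists>rstar. smallest_radius c A rstar \<and>
           rstar = sqrt \<alpha> \<and>
           rstar = sqrt (h_fun c A lstar) \<and>
           rstar = sqrt ((\<Sum>i\<in>UNIV. lstar $ i * (c i \<bullet> (A i *v c i)))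
                     - b_comb c A lstar \<bullet> (matrix_inv (A_comb A lstar) *v b_comb c A lstar)) \<and>
           g_fun c A lstar rstar = 0 \<and>
           E_comb c A lstar rstar = {m_comb c A lstar}"
proof -
  let ?h = "h_fun c A lstar" and ?m = "m_comb c A lstar"
  have spd: "\<forall>i. spd (A i)"
    using assms(1) by blast
  have l: "lstar \<in> prob_simplex"
    and "\<And>l'. l' \<in> prob_simplex \<Longrightarrow> h_fun c A l' \<le> ?h"
    using assms(2) by (auto simp: is_arg_min_linorder F_fun_def)
  then have le_h: "sq_dist c A i ?m \<le> ?h" for i
    using sq_dist_m_comb_le[OF spd] by blast
  have weighted_le: "(\<Sum>i\<in>UNIV. lstar $ i * sq_dist c A i x) \<le> u"
    if "\<And>i. sq_dist c A i x \<le> u" for x u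
  proof -
    have "(\<Sum>i\<in>UNIV. lstar $ i * sq_dist c A i x) \<le> (\<Sum>i\<in>UNIV. lstar $ i * u)"
      using l that by (intro sum_mono mult_left_mono) (auto simp: prob_simplex_def)
    also have "\<dots> = u"
      using l by (simp add: prob_simplex_def sum_distrib_right[symmetric])
    finally show ?thesis .
  qed
  \<comment> \<open>Weak duality, used twice: with \<open>u = \<alpha>\<close> at \<open>?m\<close>,
    and with \<open>u\<close> the square of a feasible radius \<open>s\<close>.\<close>
  have h_le: "?h \<le> u" if "\<And>i. sq_dist c A i x \<le> u" for x u
    using weighted_le[OF that] weighted_sq_dist[OF spd l, of c x]
      spd_nonneg[OF spd_A_comb[OF spd l], of "x - ?m"] by linarith
  have \<alpha>: "\<alpha> = Max (range (\<lambda>i. sq_dist c A i ?m))"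
    using assms(3) by (simp add: mat_norm_eq_sq_dist[OF spd])
  have "\<alpha> = ?h"
  proof (rule antisym)
    show "\<alpha> \<le> ?h"
      using le_h by (simp add: \<alpha>)
    show "?h \<le> \<alpha>"
      by (rule h_le[of ?m]) (simp add: \<alpha>)
  qed
  \<comment> \<open>Makes the square of \<open>sqrt ?h\<close> equal to \<open>?h\<close>.\<close>
  have h_nonneg: "?h \<ge> 0"
    using le_h sq_dist_nonneg[OF spd] order_trans by blast
  have mem: "x \<in> (\<Inter>i. ellipsoid s (c i) (A i)) \<longleftrightarrow> (\<forall>i. sq_dist c A i x \<le> s\<^sup>2)" for x s
    by (simp add: ellipsoid_def sq_dist_def)
  have "smallest_radius c A (sqrt ?h)"
    unfolding smallest_radius_def
  proof (intro conjI allI impI)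
    have "?m \<in> (\<Inter>i. ellipsoid (sqrt ?h) (c i) (A i))"
      using le_h h_nonneg by (simp only: mem) simp
    then show "(\<Inter>i. ellipsoid (sqrt ?h) (c i) (A i)) \<noteq> {}"
      by blast
  next
    fix s :: real
    assume "s \<ge> 0" "(\<Inter>i. ellipsoid s (c i) (A i)) \<noteq> {}"
    then show "sqrt ?h \<le> s"
      using h_le mem by (metis ex_in_conv real_le_lsqrt)
  qed (use h_nonneg in simp)
  \<comment> \<open>At this radius the constant term of the completed square is zero; the remaining
    definite form is nonpositive only at \<open>?m\<close>.\<close>
  moreover have "E_comb c A lstar (sqrt ?h) = {?m}"
    using h_nonneg spd_nonpos_iff[OF spd_A_comb[OF spd l]]
    by (auto simp: E_comb_def weighted_quad_fun[OF spd l])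
  ultimately show ?thesis
    using \<open>\<alpha> = ?h\<close> h_nonneg by (auto simp: g_fun_eq_h_fun[OF l] h_fun_def)
qed

end
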